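(* Let $1\le d\le n$ be integers and let $X\subseteq\mathbb{Z}^n$ be a finite set. If $\mathrm{ic}(X)=X$ and $X$ is contained in a $d$-dimensional affine subspace of $\mathbb{R}^n$, then $$c(X)\ \le\ c(d,|X|)+2(2^n-2).$$
   Context: For $V\subseteq\mathbb{R}^n$ let $\mathrm{ic}(V)=\mathrm{conv}(V)\cap\mathbb{Z}^n$. For integers $n\ge1$, $k\ge0$, $c(n,k)$ denotes the least integer such that for every $m$, every matrix $A\in\mathbb{R}^{m\times n}$ and every $b\in\mathbb{R}^m$: if the polyhedron $\{x\in\mathbb{R}^n : Ax\le b\}$ contains exactly $k$ integer points (points of $\mathbb{Z}^n$), then there is a subset $I$ of the rows of $A$ with $|I|\le c(n,k)$ such that $\{x\in\mathbb{R}^n : A_Ix\le b_I\}$ contains exactly the same $k$ integer points, where $A_I,b_I$ are the restrictions to the rows in $I$. A system of inequalities $Ax\le b$ is non-redundant (with respect to $\mathbb{Z}^n$) if removing any one of its inequalities strictly enlarges its set of solutions in $\mathbb{Z}^n$. For $X\subseteq\mathbb{Z}^n$, $c(X)$ is the smallest upper bound (supremum) on the number $m$ of inequalities in a non-redundant system $Ax\le b$, $A\in\mathbb{R}^{m\times n}$, $b\in\mathbb{R}^m$, with $\{x\in\mathbb{R}^n: Ax\le b\}\cap\mathbb{Z}^n=X$; if no such system exists, $c(X)=-\infty$. *)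

theory Defs
  imports "HOL-Analysis.Analysis"
begin

definition int_lattice :: "(real ^ 'n::finite) set" where
  "int_lattice = {x. \<forall>j. x $ j \<in> \<int>}"

definition ic :: "(real ^ 'n::finite) set \<Rightarrow> (real ^ 'n) set" where
  "ic V = convex hull V \<inter> int_lattice"

text \<open>A system $Ax \le b$ with $m$ rows is given by the rows \<open>A i\<close> and right-hand sides
  \<open>b i\<close> for \<open>i < m\<close>; values at \<open>i \<ge> m\<close> are irrelevant. \<open>sols A b I\<close> is the solution set of the
  subsystem $A_I x \le b_I$, so that the whole system is the case \<open>I = {..<m}\<close>.\<close>

definition sols :: "(nat \<Rightarrow> real ^ 'n::finite) \<Rightarrow> (nat \<Rightarrow> real) \<Rightarrow> nat set \<Rightarrow> (real ^ 'n) set" where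
  "sols A b I = {x. \<forall>i\<in>I. A i \<bullet> x \<le> b i}"

definition int_sols :: "(nat \<Rightarrow> real ^ 'n::finite) \<Rightarrow> (nat \<Rightarrow> real) \<Rightarrow> nat set \<Rightarrow> (real ^ 'n) set" where
  "int_sols A b I = sols A b I \<inter> int_lattice"

text \<open>The number $c(n,k)$, with the dimension passed as an index type: \<open>c_num TYPE('n) k\<close> is
  $c(n,k)$ for $n$ = \<open>CARD('n)\<close>. Any admissible integer bounds a cardinality and some
  system in $\mathbb{R}^n$ has exactly $k$ integer solutions, so the least
  integer is a least natural number. Finiteness is required explicitly because infinite
  sets have \<open>card\<close> zero.\<close>

definition c_num :: "'n::finite itself \<Rightarrow> nat \<Rightarrow> nat" where
  "c_num T k = (LEAST c. \<forall>m (A :: nat \<Rightarrow> real ^ 'n) b.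
     finite (int_sols A b {..<m}) \<and> card (int_sols A b {..<m}) = k \<longrightarrow>
     (\<exists>I \<subseteq> {..<m}. card I \<le> c \<and> int_sols A b I = int_sols A b {..<m}))"

definition nonredundant :: "(nat \<Rightarrow> real ^ 'n::finite) \<Rightarrow> (nat \<Rightarrow> real) \<Rightarrow> nat \<Rightarrow> bool" where
  "nonredundant A b m \<longleftrightarrow> (\<forall>i<m. int_sols A b {..<m} \<subset> int_sols A b ({..<m} - {i}))"

text \<open>In \<open>ereal\<close> the supremum of the empty set is $-\infty$, which is the value of $c(X)$ when
  \<open>X\<close> is not the set of integer solutions of any non-redundant system.\<close>

definition c_set :: "(real ^ 'n::finite) set \<Rightarrow> ereal" where
  "c_set X = (SUP m \<in> {m. \<exists>A b. nonredundant A b m \<and> int_sols A b {..<m} = X}. ereal (real m))"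

end

theory Submission
  imports Defs
begin

text \<open>
  Let \<open>A x \<le> b\<close> be a non-redundant system with \<open>m\<close> inequalities and integer solution set \<open>X\<close>.
  Each inequality cuts off a lattice point that satisfies all the others. These witnesses can be
  chosen so well that they form a set \<open>Y\<close> of \<open>m\<close> lattice points \<^emph>\<open>surrounding\<close> \<open>X\<close>: the convex
  hull of \<open>X \<union> Y\<close> has no further lattice point, and each \<open>y \<in> Y\<close> is a vertex of it outside \<open>X\<close>
  (\<open>surrounding_set_of_irredundant_system\<close>). It remains to bound the size of a surrounding set.

  Call two lattice points of the same parity if they agree modulo 2 in all coordinates. If a
  point of \<open>Y\<close> and another point of \<open>X \<union> Y\<close> have the same parity, then their midpoint is a lattice
  point of the hull and not a vertex, so it lies in \<open>X\<close>, hence in the affine space \<open>S\<close>. Thus a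
  point of \<open>Y\<close> outside \<open>S\<close> never has the parity of a point of \<open>X\<close>, and each other parity class
  has at most two such points, because three points with pairwise midpoints in \<open>S\<close> lie in \<open>S\<close>.
  If \<open>X\<close> has two points, then it meets two parity classes (otherwise the midpoint of a closest
  pair would be a closer point), which leaves at most \<open>2 (2\<^sup>n - 2)\<close> points outside \<open>S\<close>.

  The points of \<open>Y\<close> in \<open>S\<close> surround \<open>X\<close> by themselves. A basis of the lattice of integer
  translations of \<open>S\<close> has at most \<open>d\<close> elements, and its coordinates carry this configuration to
  \<open>\<int>\<^sup>d\<close> (\<open>card_surrounding_in_affine_le_c_num\<close>). There, facets of the hull together with one
  inequality cutting off each surrounding point give a system from which none of the latter
  inequalities can be dropped, so the number of points is at most \<open>c(d,|X|)\<close>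
  (\<open>card_surrounding_le_c_num\<close>). For this it must be known that \<open>c(d,k)\<close> is a true bound, in other
  words that some finite bound exists; the parity argument supplies one.

  When \<open>|X| \<le> 1\<close> the set \<open>X\<close> meets fewer than two parity classes, but then counting all of \<open>Y\<close>
  by parity is enough: at most \<open>2 (2\<^sup>n - 1)\<close> points for \<open>|X| = 1\<close>, where \<open>c(d,1) \<ge> 2\<close>, and at most
  \<open>2\<^sup>n\<close> points for \<open>X = {}\<close>. The latter is too weak only for \<open>n = 1\<close>, and then \<open>S\<close> is the whole
  space.
\<close>

section \<open>Surrounding sets of lattice points\<close>

definition surrounds :: "(real ^ 'n::finite) set \<Rightarrow> (real ^ 'n) set \<Rightarrow> bool" where
  "surrounds Y X \<longleftrightarrow> finite Y \<and> Y \<inter> X = {} \<and> ic (X \<union> Y) = X \<union> Y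
     \<and> (\<forall>y\<in>Y. y \<notin> convex hull (X \<union> Y - {y}))"

lemma finite_int_lattice_bounded:
  fixes V :: "(real ^ 'n::finite) set"
  assumes "bounded V"
  shows "finite (V \<inter> int_lattice)"
proof -
  obtain B where B: "\<And>x. x \<in> V \<Longrightarrow> norm x \<le> B"
    using assms by (auto simp: bounded_iff)
  let ?N = "{r \<in> \<int>. \<bar>r\<bar> \<le> B} :: real set"
  have "?N \<subseteq> real_of_int ` {\<lfloor>-B\<rfloor>..\<lceil>B\<rceil>}"
  proof
    fix r assume "r \<in> ?N"
    then obtain i where i: "r = real_of_int i" "\<bar>r\<bar> \<le> B" by (auto elim: Ints_cases)
    then have "\<lfloor>-B\<rfloor> \<le> i" "i \<le> \<lceil>B\<rceil>" by linarith+
    with i show "r \<in> real_of_int ` {\<lfloor>-B\<rfloor>..\<lceil>B\<rceil>}" by auto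
  qed
  then have "finite ?N" by (rule finite_subset) simp
  then have "finite {f :: 'n \<Rightarrow> real. range f \<subseteq> ?N}"
    using finite_set_of_finite_funs[of "UNIV :: 'n set" ?N 0]
    by (auto simp: image_subset_iff)
  moreover have "V \<inter> int_lattice \<subseteq> vec_lambda ` {f :: 'n \<Rightarrow> real. range f \<subseteq> ?N}"
  proof
    fix x assume x: "x \<in> V \<inter> int_lattice"
    have "x = vec_lambda (($) x)" by simp
    moreover have "range (($) x) \<subseteq> ?N"
      using x B component_le_norm_cart[of x] by (fastforce simp: int_lattice_def intro: order_trans)
    ultimately show "x \<in> vec_lambda ` {f. range f \<subseteq> ?N}" by blast
  qed
  ultimately show ?thesis by (meson finite_imageI finite_subset)
qed

lemma finite_ic: "finite V \<Longrightarrow> finite (ic V)"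
  unfolding ic_def by (intro finite_int_lattice_bounded finite_imp_bounded_convex_hull)

lemma subset_ic: "V \<subseteq> int_lattice \<Longrightarrow> V \<subseteq> ic V"
  by (auto simp: ic_def hull_inc)

text \<open>On finitely many values a weak inequality can be written as a strict one with a larger
  right-hand side. The strict form is the one that can be relaxed until it is tight at an excluded
  point without admitting that point.\<close>

lemma strict_threshold:
  fixes V :: "real set"
  assumes "finite V"
  shows "\<exists>\<beta>>b. \<forall>v\<in>V. v < \<beta> \<longleftrightarrow> v \<le> b"
  using assms
proof induction
  case empty
  show ?case by (auto intro: gt_ex)
next
  case (insert v V)
  then obtain \<beta> where "\<beta> > b" "\<forall>v\<in>V. v < \<beta> \<longleftrightarrow> v \<le> b" by blast
  then show ?case
    by (intro exI[of _ "if v > b then min \<beta> v else \<beta>"]) auto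
qed

text \<open>Each threshold in turn is raised to the least value that it cuts off among the points
  satisfying all other inequalities. This admits no new point, makes the inequality tight at one
  excluded point, and keeps what was achieved for the other indices, since raising a threshold only
  helps a point that is meant to satisfy that inequality.\<close>

lemma tight_thresholds:
  fixes f :: "'i \<Rightarrow> 'a \<Rightarrow> real"
  assumes "finite F"
    and "{x\<in>F. \<forall>j\<in>I. f j x < \<beta> j} = X"
    and "\<forall>i\<in>I. \<exists>z\<in>F. \<beta> i \<le> f i z \<and> (\<forall>j\<in>I-{i}. f j z < \<beta> j)"
    and "finite K" and "K \<subseteq> I"
  shows "\<exists>\<gamma>. {x\<in>F. \<forall>j\<in>I. f j x < \<gamma> j} = X
    \<and> (\<forall>i\<in>I. \<exists>z\<in>F. \<gamma> i \<le> f i z \<and> (\<forall>j\<in>I-{i}. f j z < \<gamma> j))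
    \<and> (\<forall>i\<in>K. \<exists>z\<in>F. f i z = \<gamma> i \<and> (\<forall>j\<in>I-{i}. f j z < \<gamma> j))"
  using assms(4,5)
proof (induction K)
  case empty
  show ?case using assms by blast
next
  case (insert i K)
  then obtain \<gamma> where \<gamma>: "{x\<in>F. \<forall>j\<in>I. f j x < \<gamma> j} = X"
    "\<forall>i\<in>I. \<exists>z\<in>F. \<gamma> i \<le> f i z \<and> (\<forall>j\<in>I-{i}. f j z < \<gamma> j)"
    "\<forall>i\<in>K. \<exists>z\<in>F. f i z = \<gamma> i \<and> (\<forall>j\<in>I-{i}. f j z < \<gamma> j)" by auto
  have iI: "i \<in> I" using insert by auto
  let ?W = "{z\<in>F. \<gamma> i \<le> f i z \<and> (\<forall>j\<in>I-{i}. f j z < \<gamma> j)}"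
  have W: "finite ?W" "?W \<noteq> {}" using assms(1) \<gamma>(2) iI by auto
  define y where "y = arg_min_on (f i) ?W"
  have y: "y \<in> ?W" unfolding y_def using arg_min_if_finite(1)[OF W] .
  have ymin: "f i y \<le> f i z" if "z \<in> ?W" for z
    unfolding y_def using arg_min_least[OF W that] .
  define \<gamma>' where "\<gamma>' = \<gamma>(i := f i y)"
  have le: "\<gamma> j \<le> \<gamma>' j" for j using y by (auto simp: \<gamma>'_def)
  have lt: "f j z < \<gamma>' j" if "f j z < \<gamma> j" for j z using le[of j] that by linarith
  have "{x\<in>F. \<forall>j\<in>I. f j x < \<gamma>' j} = {x\<in>F. \<forall>j\<in>I. f j x < \<gamma> j}"
  proof (intro equalityI subsetI)
    fix x assume x: "x \<in> {x\<in>F. \<forall>j\<in>I. f j x < \<gamma>' j}"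
    have other: "\<forall>j\<in>I-{i}. f j x < \<gamma> j"
    proof
      fix j assume j: "j \<in> I-{i}"
      then have "f j x < \<gamma>' j" using x by blast
      then show "f j x < \<gamma> j" using j by (simp add: \<gamma>'_def)
    qed
    have "f i x < f i y" using x iI by (auto simp: \<gamma>'_def)
    then have "x \<notin> ?W" using ymin[of x] by linarith
    then have "f i x < \<gamma> i" using x other by auto
    with other x show "x \<in> {x\<in>F. \<forall>j\<in>I. f j x < \<gamma> j}" by auto
  qed (use lt in auto)
  moreover have "\<exists>z\<in>F. f i z = \<gamma>' i \<and> (\<forall>j\<in>I-{i}. f j z < \<gamma>' j)"
    using y by (auto simp: \<gamma>'_def)
  moreover have "\<exists>z\<in>F. f k z = \<gamma>' k \<and> (\<forall>j\<in>I-{k}. f j z < \<gamma>' j)" if "k \<in> K" for k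
  proof -
    have "k \<noteq> i" using that insert by auto
    then have "\<gamma>' k = \<gamma> k" by (simp add: \<gamma>'_def)
    then show ?thesis using \<gamma>(3) that lt by metis
  qed
  moreover have "\<exists>z\<in>F. \<gamma>' k \<le> f k z \<and> (\<forall>j\<in>I-{k}. f j z < \<gamma>' j)" if "k \<in> I" for k
  proof (cases "k = i")
    case True
    then show ?thesis using y by (auto simp: \<gamma>'_def)
  next
    case False
    then have "\<gamma>' k = \<gamma> k" by (simp add: \<gamma>'_def)
    then show ?thesis using \<gamma>(2) that lt by metis
  qed
  ultimately show ?case using \<gamma>(1) by (intro exI[of _ \<gamma>']) auto
qed

text \<open>A point attaining the maximum of a linear functional uniquely among the generators also
  attains it uniquely on the hull.\<close>

lemma convex_halfspace_lt_insert:
  fixes a :: "'a::real_inner"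
  assumes "w \<in> convex hull (insert y T)" and "a \<bullet> y = g"
    and "\<And>t. t \<in> T \<Longrightarrow> a \<bullet> t < g"
  shows "w = y \<or> a \<bullet> w < g"
proof (cases "T = {}")
  case True
  then show ?thesis using assms(1) by simp
next
  case False
  then obtain u v t where uv: "u \<ge> 0" "v \<ge> 0" "u + v = 1" "t \<in> convex hull T"
    "w = u *\<^sub>R y + v *\<^sub>R t"
    using assms(1) by (auto simp: convex_hull_insert)
  have "convex hull T \<subseteq> {x. a \<bullet> x < g}"
    using assms(3) by (intro hull_minimal) (auto simp: convex_halfspace_lt)
  then have t: "a \<bullet> t < g" using uv by auto
  show ?thesis
  proof (cases "v = 0")
    case True
    then show ?thesis using uv by auto
  next
    case False
    then have "v * (a \<bullet> t) < v * g" using uv t by simp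
    moreover have "a \<bullet> w = u * g + v * (a \<bullet> t)"
      using uv assms(2) by (simp add: inner_add_right)
    moreover have "u * g + v * g = g" using uv by (metis distrib_right mult_1)
    ultimately show ?thesis by linarith
  qed
qed

text \<open>The witnesses \<open>z\<close> of irredundancy need not surround \<open>X\<close>, as their hull may contain further
  lattice points. They do provide a finite set \<open>F\<close>, the lattice points of that hull, in which the
  inequalities can be tightened at new witnesses \<open>y\<close>. With tight thresholds \<open>\<gamma>\<close>, every point of the
  hull of \<open>X\<close> and the \<open>y i\<close> other than the \<open>y i\<close> themselves satisfies all inequalities strictly, so
  it is in \<open>X\<close> if it is a lattice point.\<close>

lemma surrounding_set_of_irredundant_system:
  fixes A :: "nat \<Rightarrow> real ^ 'n::finite"
  assumes I: "finite I" and X: "int_sols A b I = X" "finite X"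
    and irr: "\<And>i. i \<in> I \<Longrightarrow> int_sols A b (I - {i}) \<noteq> X"
  shows "\<exists>Y. card Y = card I \<and> surrounds Y X"
proof -
  have "\<exists>z\<in>int_lattice. b i < A i \<bullet> z \<and> (\<forall>j\<in>I-{i}. A j \<bullet> z \<le> b j)" if i: "i \<in> I" for i
  proof -
    have "X \<subseteq> int_sols A b (I - {i})" using X(1) by (auto simp: int_sols_def sols_def)
    then obtain z where z: "z \<in> int_sols A b (I - {i})" "z \<notin> X" using irr[OF i] by auto
    then show ?thesis using X(1) by (force simp: int_sols_def sols_def not_le)
  qed
  then obtain z where z: "\<And>i. i \<in> I \<Longrightarrow> z i \<in> int_lattice" "\<And>i. i \<in> I \<Longrightarrow> b i < A i \<bullet> z i"
    "\<And>i j. i \<in> I \<Longrightarrow> j \<in> I - {i} \<Longrightarrow> A j \<bullet> z i \<le> b j" by metis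
  define F where "F = ic (X \<union> z ` I)"
  have Xl: "X \<subseteq> int_lattice" using X by (auto simp: int_sols_def)
  have F: "finite F" unfolding F_def using I X by (intro finite_ic) auto
  have XzF: "X \<union> z ` I \<subseteq> F" unfolding F_def using Xl z(1) by (intro subset_ic) auto
  have "\<exists>\<beta>. \<forall>v\<in>(\<lambda>x. A j \<bullet> x) ` F. v < \<beta> \<longleftrightarrow> v \<le> b j" for j
    using strict_threshold[of "(\<lambda>x. A j \<bullet> x) ` F" "b j"] F by blast
  then obtain \<beta> where \<beta>: "\<And>j x. x \<in> F \<Longrightarrow> A j \<bullet> x < \<beta> j \<longleftrightarrow> A j \<bullet> x \<le> b j"
    by (metis imageI)
  have base: "{x\<in>F. \<forall>j\<in>I. A j \<bullet> x < \<beta> j} = X"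
    using X(1) XzF \<beta> by (auto simp: int_sols_def sols_def F_def ic_def)
  have wit: "\<forall>i\<in>I. \<exists>z\<in>F. \<beta> i \<le> A i \<bullet> z \<and> (\<forall>j\<in>I-{i}. A j \<bullet> z < \<beta> j)"
  proof
    fix i assume i: "i \<in> I"
    have "z i \<in> F" using XzF i by auto
    then show "\<exists>z\<in>F. \<beta> i \<le> A i \<bullet> z \<and> (\<forall>j\<in>I-{i}. A j \<bullet> z < \<beta> j)"
      using z(2,3)[OF i] \<beta>[of "z i"] by (intro bexI[of _ "z i"]) (auto simp: not_less[symmetric] not_le)
  qed
  obtain \<gamma> where \<gamma>: "{x\<in>F. \<forall>j\<in>I. A j \<bullet> x < \<gamma> j} = X"
    "\<forall>i\<in>I. \<exists>z\<in>F. A i \<bullet> z = \<gamma> i \<and> (\<forall>j\<in>I-{i}. A j \<bullet> z < \<gamma> j)"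
    using tight_thresholds[where f = "\<lambda>j x. A j \<bullet> x", OF F base wit I order_refl]
    by (elim exE conjE) (rule that)
  obtain y where y': "\<forall>i\<in>I. y i \<in> F \<and> A i \<bullet> y i = \<gamma> i \<and> (\<forall>j\<in>I-{i}. A j \<bullet> y i < \<gamma> j)"
    using bchoice[OF \<gamma>(2)[unfolded Bex_def]] by blast
  have y: "y i \<in> F" "A i \<bullet> y i = \<gamma> i" if "i \<in> I" for i
    using y' that by auto
  have ylt: "A j \<bullet> y i < \<gamma> j" if "i \<in> I" "j \<in> I" "j \<noteq> i" for i j
    using y' that by auto
  have Xlt: "A j \<bullet> x < \<gamma> j" if "x \<in> X" "j \<in> I" for x j using \<gamma>(1) that by auto
  have inj: "inj_on y I" using y(2) ylt by (metis inj_onI less_irrefl)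
  have disj: "y ` I \<inter> X = {}" using y(2) Xlt by fastforce
  have below: "A i \<bullet> t < \<gamma> i" if "i \<in> I" "t \<in> X \<union> y ` I - {y i}" for i t
    using that Xlt ylt by (metis Diff_iff Un_iff imageE insertI1)
  have ins: "X \<union> y ` I = insert (y i) (X \<union> y ` I - {y i})" if "i \<in> I" for i using that by auto
  have sub: "X \<union> y ` I \<subseteq> F" using XzF y(1) by auto
  have "F \<subseteq> convex hull (X \<union> z ` I)" by (auto simp: F_def ic_def)
  then have "convex hull (X \<union> y ` I) \<subseteq> convex hull (X \<union> z ` I)"
    using sub by (intro hull_minimal) auto
  then have icF: "ic (X \<union> y ` I) \<subseteq> F" by (auto simp: F_def ic_def)
  have "ic (X \<union> y ` I) \<subseteq> X \<union> y ` I"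
  proof
    fix w assume w: "w \<in> ic (X \<union> y ` I)"
    show "w \<in> X \<union> y ` I"
    proof (rule ccontr)
      assume n: "w \<notin> X \<union> y ` I"
      have "A i \<bullet> w < \<gamma> i" if "i \<in> I" for i
      proof -
        have "w \<in> convex hull (insert (y i) (X \<union> y ` I - {y i}))"
          using w unfolding ic_def ins[OF that, symmetric] by simp
        then show ?thesis
          using convex_halfspace_lt_insert[of w "y i" _ "A i" "\<gamma> i", OF _ y(2)[OF that] below[OF that]] that n
          by blast
      qed
      then have "w \<in> X" using \<gamma>(1) w icF by auto
      with n show False by simp
    qed
  qed
  moreover have "X \<union> y ` I \<subseteq> ic (X \<union> y ` I)"
    using sub by (intro subset_ic) (auto simp: F_def ic_def)
  moreover have "y i \<notin> convex hull (X \<union> y ` I - {y i})" if "i \<in> I" for i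
  proof -
    have "convex hull (X \<union> y ` I - {y i}) \<subseteq> {x. A i \<bullet> x < \<gamma> i}"
      using below that by (intro hull_minimal) (auto simp: convex_halfspace_lt)
    then show ?thesis using y(2)[OF that] by auto
  qed
  ultimately have "surrounds (y ` I) X" unfolding surrounds_def using I disj by auto
  then show ?thesis using card_image[OF inj] by blast
qed

section \<open>Parity classes\<close>

definition parity :: "real ^ 'n::finite \<Rightarrow> 'n set" where
  "parity x = {j. even \<lfloor>x $ j\<rfloor>}"

lemma midpoint_int_lattice:
  assumes "x \<in> int_lattice" "y \<in> int_lattice" "parity x = parity y"
  shows "midpoint x y \<in> int_lattice"
  unfolding int_lattice_def
proof (intro CollectI allI)
  fix j
  obtain p q where pq: "x $ j = of_int p" "y $ j = of_int q"
    using assms(1,2) by (auto simp: int_lattice_def elim!: Ints_cases) (metis Ints_cases)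
  have "even p \<longleftrightarrow> even q"
    using assms(3) pq by (auto simp: parity_def set_eq_iff) (metis floor_of_int)+
  then obtain r where "p + q = 2 * r" by (metis even_add evenE)
  then have "midpoint x y $ j = of_int r"
    using pq by (simp add: midpoint_def)
  then show "midpoint x y $ j \<in> \<int>" by simp
qed

lemma surrounds_int_lattice:
  assumes "surrounds Y X"
  shows "X \<union> Y \<subseteq> int_lattice"
  using assms by (auto simp: surrounds_def ic_def)

text \<open>The midpoint is a lattice point of the hull, and it is a convex combination of two other
  points, so it cannot be one of the vertices in \<open>Y\<close>.\<close>

lemma midpoint_in_surrounded:
  assumes s: "surrounds Y X" and "y \<in> X \<union> Y" "z \<in> X \<union> Y" "y \<noteq> z" "parity y = parity z"
  shows "midpoint y z \<in> X"
proof (rule ccontr)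
  assume n: "midpoint y z \<notin> X"
  have hull: "midpoint y z \<in> convex hull T" if "y \<in> T" "z \<in> T" for T
    using that by (meson convex_contains_segment convex_convex_hull hull_inc midpoint_in_closed_segment subsetD)
  have "midpoint y z \<in> ic (X \<union> Y)"
    unfolding ic_def using assms surrounds_int_lattice[OF s]
    by (auto intro!: hull midpoint_int_lattice)
  then have "midpoint y z \<in> Y" using s n by (auto simp: surrounds_def)
  moreover have "midpoint y z \<in> convex hull (X \<union> Y - {midpoint y z})"
    using assms(2-4) by (intro hull) (metis Diff_iff midpoint_eq_endpoint singletonD)+
  ultimately show False using s by (auto simp: surrounds_def)
qed

lemma card_le_card_times_fibre:
  assumes "finite P" and "g ` V \<subseteq> P"
    and "\<And>p. p \<in> P \<Longrightarrow> finite {v\<in>V. g v = p} \<and> card {v\<in>V. g v = p} \<le> q"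
  shows "card V \<le> card P * q"
proof -
  have "V = (\<Union>p\<in>P. {v\<in>V. g v = p})" using assms(2) by auto
  then have "card V \<le> (\<Sum>p\<in>P. card {v\<in>V. g v = p})"
    using card_UN_le[OF assms(1), of "\<lambda>p. {v\<in>V. g v = p}"] by simp
  also have "\<dots> \<le> (\<Sum>p\<in>P. q)" using assms(3) by (intro sum_mono) auto
  finally show ?thesis by simp
qed

text \<open>Within one parity class, the midpoints with a fixed point of \<open>Y\<close> are distinct points of
  \<open>X\<close>. The bound is crude for large \<open>X\<close>; it serves to show that \<open>c(n,k)\<close> is
  finite, and to treat \<open>X = {}\<close>, where it says that the points of \<open>Y\<close> have different parities.\<close>

lemma card_surrounding_le:
  fixes X Y :: "(real ^ 'n::finite) set"
  assumes s: "surrounds Y X" and "finite X"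
  shows "card Y \<le> 2 ^ CARD('n) * Suc (card X)"
proof -
  have fY: "finite Y" using s by (simp add: surrounds_def)
  have "card {v\<in>Y. parity v = p} \<le> Suc (card X)" for p
  proof (cases "{v\<in>Y. parity v = p} = {}")
    case True
    then show ?thesis by (metis card.empty le0)
  next
    case False
    then obtain y where y: "y \<in> Y" "parity y = p" by auto
    let ?C = "{v\<in>Y. parity v = p}"
    have "inj_on (midpoint y) (?C - {y})"
      by (auto simp: inj_on_def midpoint_def)
    moreover have "midpoint y ` (?C - {y}) \<subseteq> X"
      using midpoint_in_surrounded[OF s] y by auto
    ultimately have "card (?C - {y}) \<le> card X"
      using assms(2) by (meson card_inj_on_le)
    then show ?thesis using y fY by (simp add: card_Diff_singleton_if)
  qed
  then have "card Y \<le> card (UNIV :: 'n set set) * Suc (card X)"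
    using fY by (intro card_le_card_times_fibre[where g = parity]) auto
  then show ?thesis by (simp add: card_UNIV_set)
qed

text \<open>Reflecting a point of \<open>X\<close> in a midpoint that lies in \<open>S\<close> stays in \<open>S\<close>, so no class of \<open>X\<close>
  contributes. In any other class, three points would be affine combinations of their pairwise
  midpoints, which lie in \<open>S\<close>.\<close>

lemma card_surrounding_outside_affine_le:
  fixes X Y :: "(real ^ 'n::finite) set"
  assumes s: "surrounds Y X" and S: "affine S" "X \<subseteq> S"
  shows "card (Y - S) \<le> (2 ^ CARD('n) - card (parity ` X)) * 2"
proof -
  have fY: "finite Y" using s by (simp add: surrounds_def)
  have aff: "a + b - c \<in> S" if "a \<in> S" "b \<in> S" "c \<in> S" for a b c
  proof -
    have "1 *\<^sub>R a + 1 *\<^sub>R b + (-1) *\<^sub>R c \<in> S"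
      using mem_affine_3[OF S(1) that, of 1 1 "-1"] by simp
    then show ?thesis by simp
  qed
  have "parity ` (Y - S) \<subseteq> - parity ` X"
  proof
    fix p assume "p \<in> parity ` (Y - S)"
    then obtain y where y: "y \<in> Y" "y \<notin> S" "p = parity y" by auto
    show "p \<in> - parity ` X"
    proof
      assume "p \<in> parity ` X"
      then obtain x where x: "x \<in> X" "parity x = parity y" using y by auto
      then have "midpoint x y \<in> S"
        using midpoint_in_surrounded[OF s, of x y] y S by auto
      then have "midpoint x y + midpoint x y - x \<in> S" using aff[of "midpoint x y" "midpoint x y" x] x S by auto
      moreover have "midpoint x y + midpoint x y - x = y" by (simp add: midpoint_def vec_eq_iff field_simps)
      ultimately show False using y by simp
    qed
  qed
  moreover have "card {v\<in>Y - S. parity v = p} \<le> 2" for p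
  proof (rule ccontr)
    assume "\<not> card {v\<in>Y - S. parity v = p} \<le> 2"
    then have "3 \<le> card {v\<in>Y - S. parity v = p}" by simp
    then obtain T where T: "T \<subseteq> {v\<in>Y - S. parity v = p}" "card T = 3"
      by (meson obtain_subset_with_card_n)
    then obtain u v w where uvw: "T = {u,v,w}" "u \<noteq> v" "v \<noteq> w" "u \<noteq> w"
      by (auto simp: card_3_iff)
    then have "midpoint u v \<in> S" "midpoint u w \<in> S" "midpoint v w \<in> S"
      using T S midpoint_in_surrounded[OF s, of u v] midpoint_in_surrounded[OF s, of u w]
        midpoint_in_surrounded[OF s, of v w] by auto
    then have "midpoint u v + midpoint u w - midpoint v w \<in> S" by (rule aff)
    moreover have "midpoint u v + midpoint u w - midpoint v w = u"
      by (simp add: midpoint_def vec_eq_iff field_simps)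
    ultimately show False using T uvw by auto
  qed
  ultimately have "card (Y - S) \<le> card (- parity ` X) * 2"
    using fY by (intro card_le_card_times_fibre[where g = parity]) auto
  also have "card (- parity ` X) = 2 ^ CARD('n) - card (parity ` X)"
    by (simp add: Compl_eq_Diff_UNIV card_Diff_subset card_UNIV_set)
  finally show ?thesis .
qed

lemma card_surrounding_empty_le:
  fixes Y :: "(real ^ 'n::finite) set"
  assumes s: "surrounds Y {}"
  shows "card Y \<le> 2 ^ CARD('n)"
  using card_surrounding_le[OF s] by simp

text \<open>Otherwise the midpoint of a closest pair of distinct points would be in \<open>X\<close> and closer.\<close>

lemma two_parities:
  assumes "finite X" and "ic X = X" and "2 \<le> card X"
  shows "2 \<le> card (parity ` X)"
proof (rule ccontr)
  assume "\<not> 2 \<le> card (parity ` X)"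
  then have "card (parity ` X) \<le> Suc 0" by simp
  then have par: "parity x = parity y" if "x \<in> X" "y \<in> X" for x y
    using that assms(1) card_le_Suc0_iff_eq[of "parity ` X"] by (metis finite_imageI imageI)
  let ?D = "{(x,y). x \<in> X \<and> y \<in> X \<and> x \<noteq> y}"
  have "finite ?D" using assms(1) by (auto intro: finite_subset[of _ "X \<times> X"])
  moreover have "?D \<noteq> {}"
  proof -
    have "\<not> card X \<le> Suc 0" using assms(3) by simp
    then obtain x y where "x \<in> X" "y \<in> X" "x \<noteq> y"
      using assms(1) by (metis card_le_Suc0_iff_eq)
    then have "(x, y) \<in> ?D" by simp
    then show ?thesis by blast
  qed
  ultimately have D: "finite ?D" "?D \<noteq> {}" by blast+
  define q where "q = arg_min_on (\<lambda>(x,y). dist x y) ?D"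
  have q: "q \<in> ?D" "\<And>r. r \<in> ?D \<Longrightarrow> (\<lambda>(x,y). dist x y) q \<le> (\<lambda>(x,y). dist x y) r"
    unfolding q_def by (rule arg_min_if_finite(1)[OF D], rule arg_min_least[OF D])
  obtain x y where xy: "x \<in> X" "y \<in> X" "x \<noteq> y" "q = (x,y)" using q(1) by auto
  have "midpoint x y \<in> convex hull X"
    using xy by (meson convex_contains_segment convex_convex_hull hull_inc midpoint_in_closed_segment subsetD)
  moreover have "X \<subseteq> int_lattice" using assms(2) by (auto simp: ic_def)
  then have "midpoint x y \<in> int_lattice"
    using xy midpoint_int_lattice[OF _ _ par[of x y]] by blast
  ultimately have "midpoint x y \<in> X" using assms(2) by (auto simp: ic_def)
  moreover have "x \<noteq> midpoint x y" using xy(3) by (metis midpoint_eq_endpoint(1))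
  ultimately have "dist x y \<le> dist x (midpoint x y)" using q(2)[of "(x, midpoint x y)"] xy by auto
  then show False using xy by (simp add: dist_midpoint)
qed

section \<open>Surrounding sets and the number c(d,k)\<close>

text \<open>A least element has the defining property only if some number has it. A subsystem of least
  size with the same integer solutions is irredundant, so its size is the size of a surrounding set,
  which is bounded by parity.\<close>

lemma c_num_bounds:
  fixes A :: "nat \<Rightarrow> real ^ 'd::finite"
  assumes "finite (int_sols A b {..<m})" and "card (int_sols A b {..<m}) = k"
  shows "\<exists>I \<subseteq> {..<m}. card I \<le> c_num TYPE('d) k \<and> int_sols A b I = int_sols A b {..<m}"
proof -
  define P where "P c \<longleftrightarrow> (\<forall>m (A :: nat \<Rightarrow> real ^ 'd) b.
     finite (int_sols A b {..<m}) \<and> card (int_sols A b {..<m}) = k \<longrightarrow>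
     (\<exists>I \<subseteq> {..<m}. card I \<le> c \<and> int_sols A b I = int_sols A b {..<m}))" for c
  have "P (2 ^ CARD('d) * Suc k)"
    unfolding P_def
  proof (intro allI impI)
    fix m b and A :: "nat \<Rightarrow> real ^ 'd"
    assume fin: "finite (int_sols A b {..<m}) \<and> card (int_sols A b {..<m}) = k"
    let ?Q = "\<lambda>I. I \<subseteq> {..<m} \<and> int_sols A b I = int_sols A b {..<m}"
    obtain I where I: "?Q I" and min: "\<And>J. ?Q J \<Longrightarrow> card I \<le> card J"
      using ex_has_least_nat[of ?Q "{..<m}" card] by auto
    have fI: "finite I" using I finite_subset by blast
    have "int_sols A b (I - {i}) \<noteq> int_sols A b {..<m}" if "i \<in> I" for i
    proof
      assume "int_sols A b (I - {i}) = int_sols A b {..<m}"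
      then have "card I \<le> card (I - {i})" using I by (intro min) auto
      moreover have "card (I - {i}) < card I" using card_Diff1_less[OF fI that] .
      ultimately show False by simp
    qed
    then obtain Y where Y: "card Y = card I" "surrounds Y (int_sols A b {..<m})"
      using surrounding_set_of_irredundant_system[OF fI, of A b "int_sols A b {..<m}"] I fin by auto
    then have "card I \<le> 2 ^ CARD('d) * Suc k"
      using card_surrounding_le[OF Y(2)] fin by simp
    then show "\<exists>I \<subseteq> {..<m}. card I \<le> 2 ^ CARD('d) * Suc k \<and> int_sols A b I = int_sols A b {..<m}"
      using I by blast
  qed
  then have "P (LEAST c. P c)" by (rule LeastI)
  then have "P (c_num TYPE('d) k)" unfolding c_num_def P_def .
  then show ?thesis using assms unfolding P_def by blast
qed

text \<open>The system consists of the facets of the hull of \<open>X \<union> Y\<close> and, for each \<open>y \<in> Y\<close>, an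
  inequality separating \<open>y\<close> from the other points. Its integer solutions are exactly \<open>X\<close>, and
  each row is violated by at most one point of \<open>Y\<close>, so a subsystem with the same integer
  solutions has at least \<open>card Y\<close> rows.\<close>

lemma card_surrounding_le_c_num:
  fixes X Y :: "(real ^ 'd::finite) set"
  assumes s: "surrounds Y X" and "finite X"
  shows "card Y \<le> c_num TYPE('d) (card X)"
proof -
  have fY: "finite Y" using s by (simp add: surrounds_def)
  let ?V = "X \<union> Y"
  have fV: "finite ?V" using fY assms by simp
  have "polyhedron (convex hull ?V)"
    using fV by (intro polytope_imp_polyhedron) (auto simp: polytope_def)
  then obtain H where H: "finite H" "convex hull ?V = \<Inter>H"
    "\<And>h. h \<in> H \<Longrightarrow> \<exists>a b. h = {x. a \<bullet> x \<le> b}"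
    unfolding polyhedron_def by metis
  have sep: "\<exists>a b. (\<forall>x\<in>?V - {y}. a \<bullet> x \<le> b) \<and> b < a \<bullet> y" if "y \<in> Y" for y
  proof -
    have "closed (convex hull (?V - {y}))"
      using fV by (simp add: finite_imp_compact_convex_hull compact_imp_closed)
    moreover have "y \<notin> convex hull (?V - {y})" using s that by (simp add: surrounds_def)
    ultimately obtain a b where ab: "a \<bullet> y < b" "\<And>x. x \<in> convex hull (?V - {y}) \<Longrightarrow> b < a \<bullet> x"
      using separating_hyperplane_closed_point[OF convex_convex_hull] by metis
    then show ?thesis
      by (intro exI[of _ "-a"] exI[of _ "-b"]) (auto simp: hull_inc less_imp_le)
  qed
  obtain a\<^sub>H b\<^sub>H where aH: "\<And>h. h \<in> H \<Longrightarrow> h = {x. a\<^sub>H h \<bullet> x \<le> b\<^sub>H h}"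
    using H(3) by metis
  obtain a\<^sub>Y b\<^sub>Y where aY: "\<And>y x. y \<in> Y \<Longrightarrow> x \<in> ?V - {y} \<Longrightarrow> a\<^sub>Y y \<bullet> x \<le> b\<^sub>Y y"
    "\<And>y. y \<in> Y \<Longrightarrow> b\<^sub>Y y < a\<^sub>Y y \<bullet> y"
    using sep by metis
  let ?R = "(\<lambda>h. (a\<^sub>H h, b\<^sub>H h)) ` H \<union> (\<lambda>y. (a\<^sub>Y y, b\<^sub>Y y)) ` Y"
  have "finite ?R" using H(1) fY by simp
  from finite_list[OF this] obtain rs where rs: "set rs = ?R" by (elim exE) (rule that)
  define m where "m = length rs"
  define A where "A i = fst (rs ! i)" for i
  define b where "b i = snd (rs ! i)" for i
  have rows: "(\<lambda>i. (A i, b i)) ` {..<m} = ?R"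
  proof -
    have "(\<lambda>i. (A i, b i)) ` {..<m} = set rs"
      by (auto simp: A_def b_def m_def set_conv_nth)
    then show ?thesis using rs by simp
  qed
  have sols_R: "sols A b {..<m} = {x. \<forall>(a,c)\<in>?R. a \<bullet> x \<le> c}"
    unfolding rows[symmetric] sols_def by auto
  have inHull: "x \<in> convex hull ?V \<longleftrightarrow> (\<forall>h\<in>H. a\<^sub>H h \<bullet> x \<le> b\<^sub>H h)" for x
    using aH H(2) by auto
  have XY: "Y \<inter> X = {}" "ic ?V = ?V" using s by (auto simp: surrounds_def)
  have solX: "int_sols A b {..<m} = X"
  proof (intro equalityI subsetI)
    fix x assume x: "x \<in> int_sols A b {..<m}"
    then have *: "\<forall>h\<in>H. a\<^sub>H h \<bullet> x \<le> b\<^sub>H h" "\<forall>y\<in>Y. a\<^sub>Y y \<bullet> x \<le> b\<^sub>Y y" "x \<in> int_lattice"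
      by (auto simp: int_sols_def sols_R)
    then have "x \<in> ic ?V" using inHull by (auto simp: ic_def)
    then have "x \<in> ?V" using XY by simp
    moreover have "x \<notin> Y" using *(2) aY(2) by (meson leD)
    ultimately show "x \<in> X" by simp
  next
    fix x assume x: "x \<in> X"
    have "\<forall>h\<in>H. a\<^sub>H h \<bullet> x \<le> b\<^sub>H h" using inHull[of x] x by (simp add: hull_inc)
    moreover have "\<forall>y\<in>Y. a\<^sub>Y y \<bullet> x \<le> b\<^sub>Y y" using aY(1) x XY by blast
    moreover have "x \<in> int_lattice" using x surrounds_int_lattice[OF s] by auto
    ultimately show "x \<in> int_sols A b {..<m}" by (auto simp: int_sols_def sols_R)
  qed
  then obtain I where I: "I \<subseteq> {..<m}" "card I \<le> c_num TYPE('d) (card X)" "int_sols A b I = X"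
    using c_num_bounds[of A b m "card X"] assms(2) by auto
  have "\<exists>i\<in>I. b i < A i \<bullet> y" if "y \<in> Y" for y
  proof -
    have "y \<notin> int_sols A b I" using I(3) that XY by auto
    moreover have "y \<in> int_lattice" using that surrounds_int_lattice[OF s] by auto
    ultimately show ?thesis by (auto simp: int_sols_def sols_def not_le)
  qed
  then obtain i where i: "\<And>y. y \<in> Y \<Longrightarrow> i y \<in> I" "\<And>y. y \<in> Y \<Longrightarrow> b (i y) < A (i y) \<bullet> y" by metis
  have cuts_one: "y = y'" if "j < m" "y \<in> Y" "y' \<in> Y" "b j < A j \<bullet> y" "b j < A j \<bullet> y'" for j y y'
  proof -
    have "(A j, b j) \<in> ?R" using rows that(1) by blast
    moreover have "(A j, b j) \<noteq> (a\<^sub>H h, b\<^sub>H h)" if "h \<in> H" for h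
      using inHull[of y] \<open>y \<in> Y\<close> \<open>b j < A j \<bullet> y\<close> that by (auto simp: hull_inc not_le[symmetric])
    ultimately obtain v where v: "v \<in> Y" "A j = a\<^sub>Y v" "b j = b\<^sub>Y v" by auto
    then have "y = v" "y' = v" using aY(1)[of v] that by (metis DiffI UnI2 leD singletonD)+
    then show ?thesis by simp
  qed
  have "inj_on i Y"
    using i I(1) by (intro inj_onI cuts_one) (auto simp: subset_iff)
  moreover have "finite I" using I(1) finite_subset by blast
  ultimately have "card Y \<le> card I" using i(1) by (intro card_inj_on_le[of i]) auto
  then show ?thesis using I(2) by simp
qed

section \<open>Lattice points in an affine subspace\<close>

text \<open>Induction on the set \<open>J\<close> of coordinates that may be nonzero. The \<open>j\<close>-th coordinates of the
  elements of the group form a subgroup of the integers; an element \<open>v\<close> whose \<open>j\<close>-th coordinate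
  \<open>g\<close> is the least positive one, together with a basis of the subgroup where this coordinate
  vanishes, is a basis.\<close>

lemma int_lattice_subgroup_basis:
  fixes L :: "(real ^ 'n::finite) set"
  assumes "finite J" and "L \<subseteq> int_lattice" and "0 \<in> L" and "\<And>x y. x \<in> L \<Longrightarrow> y \<in> L \<Longrightarrow> x - y \<in> L"
    and "\<And>x j. x \<in> L \<Longrightarrow> j \<notin> J \<Longrightarrow> x $ j = 0"
  shows "\<exists>B \<subseteq> L. independent B \<and> (\<forall>x\<in>L. \<exists>c :: real ^ 'n \<Rightarrow> int. x = (\<Sum>v\<in>B. of_int (c v) *\<^sub>R v))"
  using assms
proof (induction J arbitrary: L)
  case empty
  then have "L = {0}" by (auto simp: vec_eq_iff)
  then show ?case by (intro exI[of _ "{}"]) (auto simp: independent_empty)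
next
  case (insert j J)
  note diff = insert.prems(3)
  have neg: "- x \<in> L" if "x \<in> L" for x using diff[OF insert.prems(2) that] by simp
  have add: "x + y \<in> L" if "x \<in> L" "y \<in> L" for x y using diff[OF that(1) neg[OF that(2)]] by simp
  have nat_mult: "of_nat k *\<^sub>R x \<in> L" if "x \<in> L" for k :: nat and x
    by (induction k) (auto simp: insert.prems(2) scaleR_left_distrib add that)
  have int_mult: "of_int k *\<^sub>R x \<in> L" if "x \<in> L" for k :: int and x
    using nat_mult[OF that, of "nat k"] neg[OF nat_mult[OF that, of "nat (-k)"]]
    by (cases "k \<ge> 0") auto
  define L0 where "L0 = {x\<in>L. x $ j = 0}"
  have "\<exists>B \<subseteq> L0. independent B \<and> (\<forall>x\<in>L0. \<exists>c :: real ^ 'n \<Rightarrow> int. x = (\<Sum>v\<in>B. of_int (c v) *\<^sub>R v))"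
    using insert.prems unfolding L0_def by (intro insert.IH) (auto, metis)
  then obtain B where B: "B \<subseteq> L0" "independent B"
    "\<And>x. x \<in> L0 \<Longrightarrow> \<exists>c :: real ^ 'n \<Rightarrow> int. x = (\<Sum>v\<in>B. of_int (c v) *\<^sub>R v)" by blast
  have fB: "finite B" using B(2) by (rule independent_imp_finite)
  show ?case
  proof (cases "L = L0")
    case True
    then show ?thesis using B by blast
  next
    case False
    have coord: "\<exists>i. x $ j = of_int i" if "x \<in> L" for x
    proof -
      have "x $ j \<in> \<int>" using that insert.prems(1) by (auto simp: int_lattice_def)
      then show ?thesis by (auto elim: Ints_cases)
    qed
    let ?G = "\<lambda>g::nat. 0 < g \<and> (\<exists>x\<in>L. x $ j = of_nat g)"
    have "\<exists>g. ?G g"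
    proof -
      obtain x where x: "x \<in> L" "x $ j \<noteq> 0" using False by (auto simp: L0_def)
      obtain i where i: "x $ j = of_int i" using coord x by blast
      show ?thesis
      proof (cases "i > 0")
        case True
        then show ?thesis using x i by (intro exI[of _ "nat i"]) auto
      next
        case False
        then show ?thesis using x i neg[OF x(1)]
          by (intro exI[of _ "nat (-i)"]) (auto intro!: bexI[of _ "-x"])
      qed
    qed
    define g where "g = (LEAST g. ?G g)"
    have g: "?G g" unfolding g_def using \<open>\<exists>g. ?G g\<close> by (rule LeastI_ex)
    have gmin: "g \<le> h" if "?G h" for h unfolding g_def using that by (rule Least_le)
    obtain v where v: "v \<in> L" "v $ j = of_nat g" using g by blast
    have vB: "v \<notin> span B"
    proof
      assume "v \<in> span B"
      moreover have "span B \<subseteq> {x. x $ j = 0}"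
        using B(1) by (intro span_minimal) (auto simp: L0_def subspace_def)
      ultimately show False using v g by auto
    qed
    have "independent (insert v B)" using vB B(2) by (simp add: independent_insert)
    moreover have "insert v B \<subseteq> L" using v B(1) by (auto simp: L0_def)
    moreover have "\<exists>c :: real ^ 'n \<Rightarrow> int. x = (\<Sum>v\<in>insert v B. of_int (c v) *\<^sub>R v)" if x: "x \<in> L" for x
    proof -
      obtain i where i: "x $ j = of_int i" using coord x by blast
      let ?q = "i div int g"
      let ?x = "x - of_int ?q *\<^sub>R v"
      have xL: "?x \<in> L" using diff[OF x int_mult[OF v(1)]] .
      have "?x $ j = of_int (i - ?q * int g)" using i v by simp
      also have "i - ?q * int g = i mod int g" by (simp add: minus_div_mult_eq_mod)
      finally have xj: "?x $ j = of_int (i mod int g)" .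
      have "i mod int g = 0"
      proof (rule ccontr)
        assume "i mod int g \<noteq> 0"
        moreover have "0 \<le> i mod int g" using g by simp
        ultimately have pos: "0 < i mod int g" by linarith
        then have "?G (nat (i mod int g))" using xL xj by (intro conjI bexI[of _ ?x]) auto
        then have "g \<le> nat (i mod int g)" by (rule gmin)
        moreover have "i mod int g < int g" using g by simp
        ultimately show False using pos by linarith
      qed
      then have "?x \<in> L0" using xL xj by (simp add: L0_def)
      then obtain c :: "real ^ 'n \<Rightarrow> int" where c: "?x = (\<Sum>v\<in>B. of_int (c v) *\<^sub>R v)" using B(3) by blast
      have nv: "v \<notin> B" using vB span_base by blast
      have "(\<Sum>u\<in>insert v B. of_int ((c(v := ?q)) u) *\<^sub>R u) = of_int ?q *\<^sub>R v + (\<Sum>u\<in>B. of_int ((c(v := ?q)) u) *\<^sub>R u)"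
        using fB nv by simp
      also have "(\<Sum>u\<in>B. of_int ((c(v := ?q)) u) *\<^sub>R u) = (\<Sum>u\<in>B. of_int (c u) *\<^sub>R u)"
        using nv by (intro sum.cong) auto
      finally have "x = (\<Sum>u\<in>insert v B. of_int ((c(v := ?q)) u) *\<^sub>R u)" using c by (simp add: algebra_simps)
      then show ?thesis by blast
    qed
    ultimately show ?thesis by blast
  qed
qed

lemma surrounds_Int_affine:
  assumes s: "surrounds Y X" and S: "affine S" "X \<subseteq> S"
  shows "surrounds (Y \<inter> S) X"
proof -
  have XY: "finite Y" "Y \<inter> X = {}" "ic (X \<union> Y) = X \<union> Y"
    "\<And>y. y \<in> Y \<Longrightarrow> y \<notin> convex hull (X \<union> Y - {y})" using s by (auto simp: surrounds_def)
  have "convex hull (X \<union> Y \<inter> S) \<subseteq> S"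
    using S by (intro hull_minimal) (auto intro: affine_imp_convex)
  moreover have "convex hull (X \<union> Y \<inter> S) \<subseteq> convex hull (X \<union> Y)" by (intro hull_mono) auto
  ultimately have "ic (X \<union> Y \<inter> S) \<subseteq> ic (X \<union> Y) \<inter> S" by (auto simp: ic_def)
  then have "ic (X \<union> Y \<inter> S) \<subseteq> X \<union> Y \<inter> S" using XY by auto
  moreover have "X \<union> Y \<inter> S \<subseteq> ic (X \<union> Y \<inter> S)"
    using surrounds_int_lattice[OF s] by (intro subset_ic) auto
  moreover have "y \<notin> convex hull (X \<union> Y \<inter> S - {y})" if "y \<in> Y" for y
    using XY(4)[OF that] hull_mono[of "X \<union> Y \<inter> S - {y}" "X \<union> Y - {y}" convex] by auto
  ultimately show ?thesis using XY unfolding surrounds_def by auto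
qed

text \<open>Coordinates with respect to a lattice basis \<open>B\<close> of the integer translations of \<open>S\<close> map the
  configuration to \<open>\<int>\<^sup>d\<close>. A basis is essential, rather than just independent vectors: only then
  does every lattice point of the image hull come from a lattice point of the original hull.
  The lattice may have rank less than \<open>d\<close>, in which case some coordinates stay unused. The base
  point \<open>p\<close> is taken from \<open>Y\<close>, so that the case \<open>X = {}\<close> is covered.\<close>

lemma card_surrounding_in_affine_le_c_num:
  fixes X Y S :: "(real ^ 'n::finite) set"
  assumes s: "surrounds Y X" and X: "finite X" and S: "affine S" "aff_dim S = int CARD('d::finite)"
    and sub: "X \<subseteq> S" "Y \<subseteq> S"
  shows "card Y \<le> c_num TYPE('d) (card X)"
proof (cases "Y = {}")
  case True
  then show ?thesis by simp
next
  case False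
  then obtain p where p: "p \<in> Y" by auto
  have lat: "X \<union> Y \<subseteq> int_lattice" by (rule surrounds_int_lattice[OF s])
  have pS: "p \<in> S" and pl: "p \<in> int_lattice" using p sub lat by auto
  define L where "L = {z \<in> int_lattice. p + z \<in> S}"
  have Ldiff: "x - y \<in> L" if "x \<in> L" "y \<in> L" for x y
  proof -
    have "1 *\<^sub>R (p + x) + (-1) *\<^sub>R (p + y) + 1 *\<^sub>R p \<in> S"
      using that pS by (intro mem_affine_3[OF S(1)]) (auto simp: L_def)
    then show ?thesis using that by (auto simp: L_def int_lattice_def algebra_simps)
  qed
  have "\<exists>B \<subseteq> L. independent B \<and> (\<forall>x\<in>L. \<exists>c :: real ^ 'n \<Rightarrow> int. x = (\<Sum>v\<in>B. of_int (c v) *\<^sub>R v))"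
  proof (rule int_lattice_subgroup_basis[OF finite_class.finite_UNIV])
    show "L \<subseteq> int_lattice" by (auto simp: L_def)
    show "0 \<in> L" using pS by (simp add: L_def int_lattice_def)
  qed (use Ldiff in auto)
  then obtain B where B: "B \<subseteq> L" "independent B"
    "\<And>x. x \<in> L \<Longrightarrow> \<exists>c :: real ^ 'n \<Rightarrow> int. x = (\<Sum>v\<in>B. of_int (c v) *\<^sub>R v)" by blast
  have fB: "finite B" using B(2) by (rule independent_imp_finite)
  have "int (card B) \<le> int CARD('d)"
  proof -
    let ?D = "(\<lambda>x. - p + x) ` S"
    have "subspace ?D" using S(1) pS by (rule affine_diffs_subspace)
    have "B \<subseteq> ?D" using B(1) by (force simp: L_def image_iff)
    then have "card B \<le> dim ?D" using B(2) by (rule independent_card_le_dim)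
    moreover have "aff_dim ?D = int (dim ?D)" using \<open>subspace ?D\<close> by (rule aff_dim_subspace)
    moreover have "aff_dim ?D = aff_dim S" by (rule aff_dim_translation_eq)
    ultimately show ?thesis using S(2) by simp
  qed
  then have "card B \<le> card (UNIV :: 'd set)" by simp
  then obtain e :: "real ^ 'n \<Rightarrow> 'd" where e: "inj_on e B"
    using fB by (metis card_le_inj finite)
  obtain f :: "real ^ 'n \<Rightarrow> real ^ 'd" where f: "linear f" "\<And>v. v \<in> B \<Longrightarrow> f v = axis (e v) 1"
    using linear_independent_extend[OF B(2), of "\<lambda>v. axis (e v) 1"] by blast
  define g :: "real ^ 'd \<Rightarrow> real ^ 'n" where "g u = (\<Sum>v\<in>B. (u $ e v) *\<^sub>R v)" for u
  have lg: "linear g"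
    unfolding g_def by (intro linearI) (auto simp: scaleR_left_distrib sum.distrib scaleR_right.sum)
  have gf: "g (f x) = x" if "x \<in> span B" for x
  proof -
    have "(g \<circ> f) x = id x"
    proof (rule linear_eq_on[OF linear_compose[OF f(1) lg] linear_id that])
      fix v assume v: "v \<in> B"
      have "g (f v) = (\<Sum>u\<in>B. if u = v then u else 0)"
        unfolding g_def f(2)[OF v] using e v
        by (intro sum.cong) (auto simp: axis_def inj_on_eq_iff)
      then show "(g \<circ> f) v = id v" using v fB by simp
    qed
    then show ?thesis by simp
  qed
  have gL: "g u \<in> int_lattice" if "u \<in> int_lattice" for u
    using that B(1) unfolding g_def by (auto simp: int_lattice_def L_def intro!: Ints_sum Ints_mult)
  have fL: "f x \<in> int_lattice" if "x \<in> L" for x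
  proof -
    obtain c :: "real ^ 'n \<Rightarrow> int" where "x = (\<Sum>v\<in>B. of_int (c v) *\<^sub>R v)" using B(3) \<open>x \<in> L\<close> by blast
    then have "f x = (\<Sum>v\<in>B. of_int (c v) *\<^sub>R axis (e v) 1)"
      using f by (simp add: linear_sum linear_cmul)
    then show ?thesis by (auto simp: int_lattice_def axis_def intro!: Ints_sum)
  qed
  define \<phi> where "\<phi> x = f (x - p)" for x
  define M where "M = (\<lambda>x. p + x) ` span B"
  have VM: "X \<union> Y \<subseteq> M"
  proof
    fix x assume x: "x \<in> X \<union> Y"
    then have "x - p \<in> L" using sub lat pl by (auto simp: L_def int_lattice_def)
    then obtain c :: "real ^ 'n \<Rightarrow> int" where "x - p = (\<Sum>v\<in>B. of_int (c v) *\<^sub>R v)" using B(3) by blast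
    then have "x - p \<in> span B" by (simp add: span_sum span_scale span_base)
    then show "x \<in> M" unfolding M_def by (metis add.commute diff_add_cancel image_eqI)
  qed
  have "convex M" unfolding M_def by (intro convex_translation subspace_imp_convex subspace_span)
  then have hullM: "convex hull T \<subseteq> M" if "T \<subseteq> X \<union> Y" for T
    using VM that by (intro hull_minimal) auto
  have inv: "p + g (\<phi> x) = x" if "x \<in> M" for x
    using that gf unfolding M_def \<phi>_def by auto
  have inj: "inj_on \<phi> M" using inv by (metis inj_onI)
  have hull: "convex hull (\<phi> ` T) = \<phi> ` (convex hull T)" for T
  proof -
    have "\<phi> = f \<circ> (\<lambda>x. - p + x)" by (auto simp: \<phi>_def)
    then have "\<phi> ` U = f ` ((\<lambda>x. - p + x) ` U)" for U by (simp add: image_comp)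
    then show ?thesis 
      by (simp only: convex_hull_linear_image[OF f(1)] convex_hull_translation[symmetric])
  qed
  have lat': "\<phi> ` (X \<union> Y) \<subseteq> int_lattice"
    using sub lat pl by (auto simp: \<phi>_def intro!: fL) (auto simp: L_def int_lattice_def)
  have XY: "finite Y" "Y \<inter> X = {}" "ic (X \<union> Y) = X \<union> Y"
    "\<And>y. y \<in> Y \<Longrightarrow> y \<notin> convex hull (X \<union> Y - {y})" using s by (auto simp: surrounds_def)
  have "surrounds (\<phi> ` Y) (\<phi> ` X)"
    unfolding surrounds_def
  proof (intro conjI ballI)
    show "finite (\<phi> ` Y)" using XY by simp
    show "\<phi> ` Y \<inter> \<phi> ` X = {}"
      using XY(2) VM inj by (auto simp: inj_on_eq_iff subset_iff)
    have "w \<in> \<phi> ` X \<union> \<phi> ` Y" if "w \<in> ic (\<phi> ` X \<union> \<phi> ` Y)" for w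
    proof -
      have "w \<in> convex hull (\<phi> ` (X \<union> Y))" using that by (simp add: ic_def image_Un)
      then obtain x where x: "x \<in> convex hull (X \<union> Y)" "w = \<phi> x" using hull by auto
      then have "x \<in> M" using hullM[OF order_refl] by blast
      then have "x = p + g w" using inv x(2) by simp
      moreover have "g w \<in> int_lattice" using that gL by (simp add: ic_def)
      ultimately have "x \<in> int_lattice" using pl by (auto simp: int_lattice_def)
      then have "x \<in> X \<union> Y" using x XY(3) by (auto simp: ic_def)
      then show ?thesis using x by auto
    qed
    moreover have "\<phi> ` X \<union> \<phi> ` Y \<subseteq> ic (\<phi> ` X \<union> \<phi> ` Y)"
      using lat' by (intro subset_ic) auto
    ultimately show "ic (\<phi> ` X \<union> \<phi> ` Y) = \<phi> ` X \<union> \<phi> ` Y" by auto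
    fix w assume "w \<in> \<phi> ` Y"
    then obtain y where y: "y \<in> Y" "w = \<phi> y" by auto
    have yM: "y \<in> M" using y VM by auto
    have "\<phi> ` X \<union> \<phi> ` Y - {w} \<subseteq> \<phi> ` (X \<union> Y - {y})" using y by auto
    then have sb: "convex hull (\<phi> ` X \<union> \<phi> ` Y - {w}) \<subseteq> \<phi> ` (convex hull (X \<union> Y - {y}))"
      using hull hull_mono by metis
    show "w \<notin> convex hull (\<phi> ` X \<union> \<phi> ` Y - {w})"
    proof
      assume "w \<in> convex hull (\<phi> ` X \<union> \<phi> ` Y - {w})"
      then obtain x where x: "x \<in> convex hull (X \<union> Y - {y})" "\<phi> y = \<phi> x" using sb y by auto
      then have "x = y" using inj_onD[OF inj, of y x] yM hullM[of "X \<union> Y - {y}"] by auto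
      then show False using x XY(4) y by auto
    qed
  qed
  then have "card (\<phi> ` Y) \<le> c_num TYPE('d) (card (\<phi> ` X))"
    using X by (intro card_surrounding_le_c_num) auto
  moreover have "card (\<phi> ` Y) = card Y" "card (\<phi> ` X) = card X"
    using inj VM by (auto intro!: card_image intro: inj_on_subset)
  ultimately show ?thesis by simp
qed

section \<open>Combining the bounds inside and outside the subspace\<close>

text \<open>The origin is surrounded by a unit vector and its negative.\<close>

lemma two_le_c_num_1: "2 \<le> c_num TYPE('d::finite) 1"
proof -
  obtain j :: 'd where True by blast
  define u :: "real ^ 'd" where "u = axis j 1"
  have uj: "u $ j = 1" by (simp add: u_def)
  have u0: "u \<noteq> 0" using uj by auto
  have neq: "u \<noteq> -u" using uj by (metis one_neq_neg_one vector_uminus_component)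
  have lat: "{0} \<union> {u,-u} \<subseteq> int_lattice" by (auto simp: int_lattice_def u_def axis_def)
  have "surrounds {u,-u} {0}"
    unfolding surrounds_def
  proof (intro conjI ballI)
    show "finite {u,-u}" "{u,-u} \<inter> {0} = {}" using u0 by auto
    have "w \<in> {0} \<union> {u,-u}" if w: "w \<in> ic ({0} \<union> {u,-u})" for w
    proof -
      have "convex hull ({0} \<union> {u,-u}) \<subseteq> {w. \<exists>t. w = t *\<^sub>R u \<and> \<bar>t\<bar> \<le> 1}"
      proof (rule hull_minimal)
        have "{w. \<exists>t. w = t *\<^sub>R u \<and> \<bar>t\<bar> \<le> 1} = (\<lambda>t. t *\<^sub>R u) ` {-1..1}" by (auto simp: abs_le_iff)
        then show "convex {w. \<exists>t. w = t *\<^sub>R u \<and> \<bar>t\<bar> \<le> 1}"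
          by (auto intro!: convex_linear_image linearI simp: scaleR_left_distrib)
      qed (auto intro: exI[of _ 0] exI[of _ 1] exI[of _ "-1"])
      then obtain t where t: "w = t *\<^sub>R u" "\<bar>t\<bar> \<le> 1" using w by (auto simp: ic_def)
      have "w $ j \<in> \<int>" using w by (auto simp: ic_def int_lattice_def)
      then have "t \<in> \<int>" using t uj by simp
      then obtain i where i: "t = of_int i" by (auto elim: Ints_cases)
      then have "\<bar>i\<bar> \<le> 1" using t by linarith
      then have "i = 0 \<or> i = 1 \<or> i = -1" by linarith
      then show ?thesis using i t by auto
    qed
    then show "ic ({0} \<union> {u,-u}) = {0} \<union> {u,-u}" using subset_ic[OF lat] by blast
    fix y assume "y \<in> {u,-u}"
    then show "y \<notin> convex hull ({0} \<union> {u,-u} - {y})"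
    proof
      assume y: "y = u"
      have "convex hull ({0} \<union> {u,-u} - {u}) \<subseteq> {x. u \<bullet> x < u \<bullet> u}"
        using u0 by (intro hull_minimal) (auto simp: convex_halfspace_lt)
      then show ?thesis using y by auto
    next
      assume y: "y \<in> {-u}"
      have "convex hull ({0} \<union> {u,-u} - {-u}) \<subseteq> {x. u \<bullet> x > u \<bullet> (-u)}"
        using u0 by (intro hull_minimal) (auto simp: convex_halfspace_gt)
      then show ?thesis using y by auto
    qed
  qed
  then have "card {u,-u} \<le> c_num TYPE('d) (card {0::real ^ 'd})"
    by (intro card_surrounding_le_c_num) auto
  then show ?thesis using neq by simp
qed

lemma card_surrounding_le_affine_bound:
  fixes X Y S :: "(real ^ 'n::finite) set"
  assumes d: "CARD('d::finite) \<le> CARD('n)" and s: "surrounds Y X"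
    and X: "finite X" "ic X = X" and S: "affine S" "aff_dim S = int CARD('d)" "X \<subseteq> S"
  shows "card Y \<le> c_num TYPE('d) (card X) + 2 * (2 ^ CARD('n) - 2)"
proof -
  have fY: "finite Y" using s by (simp add: surrounds_def)
  have inside: "card (Y \<inter> S) \<le> c_num TYPE('d) (card X)"
    using S X surrounds_Int_affine[OF s S(1,3)] by (intro card_surrounding_in_affine_le_c_num) auto
  have split: "card Y = card (Y \<inter> S) + card (Y - S)"
    using fY by (metis card_Int_Diff)
  consider "2 \<le> card X" | "card X = 1" | "X = {}" "CARD('n) = 1" | "X = {}" "2 \<le> CARD('n)"
    using X(1) zero_less_card_finite[where 'a='n] by (cases "card X = 0"; cases "CARD('n) = 1") fastforce+
  then show ?thesis
  proof cases
    case 1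
    then have "2 \<le> card (parity ` X)" using X two_parities by blast
    then have "card (Y - S) \<le> (2 ^ CARD('n) - 2) * 2"
      using card_surrounding_outside_affine_le[OF s S(1,3)] by (meson diff_le_mono2 le_trans mult_le_mono1)
    then show ?thesis using inside split by simp
  next
    case 2
    then obtain x where x: "X = {x}" by (auto simp: card_1_singleton_iff)
    \<comment> \<open>A single point is an affine space, so \<open>X\<close> can take the place of \<open>S\<close> in counting \<open>Y\<close>.\<close>
    have "Y - X = Y" using s by (auto simp: surrounds_def)
    then have "card Y \<le> (2 ^ CARD('n) - 1) * 2"
      using card_surrounding_outside_affine_le[OF s, of X] x by simp
    moreover have "(2::nat) \<le> 2 ^ CARD('n)" using zero_less_card_finite[where 'a='n] by (simp add: self_le_power)
    ultimately show ?thesis using two_le_c_num_1[where 'd='d] 2 by simp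
  next
    case 3
    have "CARD('d) = CARD('n)" using d 3 zero_less_card_finite[where 'a='d] by linarith
    then have "aff_dim S = int DIM(real ^ 'n)" using S(2) by simp
    then have "S = UNIV" using S(1) aff_dim_eq_full[of S] affine_hull_eq[of S] by metis
    then show ?thesis using inside by simp
  next
    case 4
    then have "card Y \<le> 2 ^ CARD('n)" using card_surrounding_empty_le s by blast
    moreover have "(2::nat) ^ 2 \<le> 2 ^ CARD('n)" using 4 by (intro power_increasing) auto
    ultimately show ?thesis by simp
  qed
qed

theorem theorem3p12:
  fixes X S :: "(real ^ 'n::finite) set"
  assumes "CARD('d::finite) \<le> CARD('n)"
    and "X \<subseteq> int_lattice"
    and "finite X"
    and "ic X = X"
    and "affine S"
    and "aff_dim S = int CARD('d)"
    and "X \<subseteq> S"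
  shows "c_set X \<le> ereal (real (c_num TYPE('d) (card X)) + 2 * (2 ^ CARD('n) - 2))"
  unfolding c_set_def
proof (rule SUP_least)
  fix m assume "m \<in> {m. \<exists>A b. nonredundant A b m \<and> int_sols A b {..<m} = X}"
  then obtain A b where A: "nonredundant A b m" "int_sols A b {..<m} = X" by auto
  have "int_sols A b ({..<m} - {i}) \<noteq> X" if "i \<in> {..<m}" for i
    using A that by (auto simp: nonredundant_def)
  then obtain Y where Y: "card Y = m" "surrounds Y X"
    using surrounding_set_of_irredundant_system[of "{..<m}" A b X] A assms(3) by auto
  have "m \<le> c_num TYPE('d) (card X) + 2 * (2 ^ CARD('n) - 2)"
    using card_surrounding_le_affine_bound[OF assms(1) Y(2) assms(3-7)] Y(1) by simp
  then have "real m \<le> real (c_num TYPE('d) (card X) + 2 * (2 ^ CARD('n) - 2))"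
    by (simp only: of_nat_le_iff)
  also have "(2::nat) \<le> 2 ^ CARD('n)" using zero_less_card_finite[where 'a='n] by (simp add: self_le_power)
  then have "real (c_num TYPE('d) (card X) + 2 * (2 ^ CARD('n) - 2))
      = real (c_num TYPE('d) (card X)) + 2 * (2 ^ CARD('n) - 2)"
    by (simp add: of_nat_diff)
  finally show "ereal (real m) \<le> ereal (real (c_num TYPE('d) (card X)) + 2 * (2 ^ CARD('n) - 2))"
    by simp
qed

end
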